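(* Let $C_0[0,\infty)$ be the complex Banach space of complex-valued functions continuous on $[0,\infty)$ and vanishing at infinity, with the norm $\|x\|_\infty:=\sup_{t\ge 0}|x(t)|$. Let $w\in\mathbb{C}$ with $|w|>1$ and let $a>0$. Then for the bounded linear weighted left translation operator on $C_0[0,\infty)$ $$(Tx)(t):=w\,x(t+a),\quad t\ge 0,$$ one has $$\sigma(T)=\{\lambda\in\mathbb{C} : |\lambda|\le |w|\}$$ with $$\sigma_p(T)=\{\lambda\in\mathbb{C} : |\lambda|<|w|\}\quad\text{and}\quad \sigma_c(T)=\{\lambda\in\mathbb{C} : |\lambda|=|w|\}.$$
   Context: For a closed linear operator $T$ in a complex Banach space $X$ (here bounded and defined on all of $X$): the resolvent set $\rho(T)$ is the set of $\lambda\in\mathbb{C}$ such that $T-\lambda I$ has an inverse that is a bounded linear operator defined on all of $X$; the spectrum is $\sigma(T):=\mathbb{C}\setminus\rho(T)$; the point spectrum $\sigma_p(T)$ is the set of eigenvalues of $T$ (those $\lambda$ for which $T-\lambda I$ is not injective); the continuous spectrum $\sigma_c(T)$ is the set of $\lambda$ for which $T-\lambda I$ is injective, not surjective, and has range dense in $X$. *)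

theory Defs
  imports "HOL-Analysis.Analysis"
begin

text \<open>
  The distribution only has type classes for real normed spaces, so complex scalars are added
  on top of them.
\<close>

class complex_normed_vector = real_normed_vector +
  fixes scaleC :: "complex \<Rightarrow> 'a \<Rightarrow> 'a"  (infixr \<open>*\<^sub>C\<close> 75)
  assumes scaleC_add_right: "c *\<^sub>C (x + y) = c *\<^sub>C x + c *\<^sub>C y"
    and scaleC_add_left: "(c + d) *\<^sub>C x = c *\<^sub>C x + d *\<^sub>C x"
    and scaleC_scaleC: "c *\<^sub>C (d *\<^sub>C x) = (c * d) *\<^sub>C x"
    and scaleC_of_real: "complex_of_real r *\<^sub>C x = r *\<^sub>R x"
    and norm_scaleC: "norm (c *\<^sub>C x) = cmod c * norm x"

class complex_banach = complex_normed_vector + complete_space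

subclass (in complex_banach) banach ..

definition bounded_clinear :: "('a::complex_normed_vector \<Rightarrow> 'b::complex_normed_vector) \<Rightarrow> bool"
  where "bounded_clinear T \<longleftrightarrow> bounded_linear T \<and> (\<forall>c x. T (c *\<^sub>C x) = c *\<^sub>C T x)"

definition shifted_op :: "('a::complex_banach \<Rightarrow> 'a) \<Rightarrow> complex \<Rightarrow> 'a \<Rightarrow> 'a"
  where "shifted_op T l = (\<lambda>x. T x - l *\<^sub>C x)"

definition resolvent_set :: "('a::complex_banach \<Rightarrow> 'a) \<Rightarrow> complex set"
  where "resolvent_set T =
    {l. \<exists>S. bounded_clinear S \<and> S \<circ> shifted_op T l = id \<and> shifted_op T l \<circ> S = id}"

definition spectrum :: "('a::complex_banach \<Rightarrow> 'a) \<Rightarrow> complex set"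
  where "spectrum T = - resolvent_set T"

definition point_spectrum :: "('a::complex_banach \<Rightarrow> 'a) \<Rightarrow> complex set"
  where "point_spectrum T = {l. \<not> inj (shifted_op T l)}"

definition continuous_spectrum :: "('a::complex_banach \<Rightarrow> 'a) \<Rightarrow> complex set"
  where "continuous_spectrum T =
    {l. inj (shifted_op T l) \<and> \<not> surj (shifted_op T l) \<and> closure (range (shifted_op T l)) = UNIV}"

text \<open>
  A function on the half-line is represented by its extension by zero to the negative reals;
  this makes the representation unique and compatible with the pointwise operations.
  Continuity is required on the half-line only, so a jump at zero is allowed.
\<close>

typedef c0 = "{x :: real \<Rightarrow> complex.
    continuous_on {0..} x \<and> (x \<longlongrightarrow> 0) at_top \<and> (\<forall>t<0. x t = 0)}"
  morphisms c0_apply Abs_c0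
  by (rule exI[of _ "\<lambda>_. 0"]) auto

setup_lifting type_definition_c0

lemma c0_eqI: "(\<And>t. t \<ge> 0 \<Longrightarrow> c0_apply x t = c0_apply y t) \<Longrightarrow> x = y"
  by transfer (metis ext not_less)

lemma c0_apply_neg: "t < 0 \<Longrightarrow> c0_apply x t = 0"
  by transfer auto

lemma continuous_on_c0_apply: "continuous_on {0..} (c0_apply x)"
  by transfer auto

lemma tendsto_c0_apply: "(c0_apply x \<longlongrightarrow> 0) at_top"
  by transfer auto

lemma bounded_c0_apply: "bounded (c0_apply x ` {0..})"
proof -
  have "eventually (\<lambda>t. cmod (c0_apply x t) < 1) at_top"
    using tendstoD[OF tendsto_c0_apply, of 1 x] by (simp add: dist_norm)
  then obtain N where N: "\<And>t. t \<ge> N \<Longrightarrow> cmod (c0_apply x t) < 1"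
    by (auto simp: eventually_at_top_linorder)
  have "compact (c0_apply x ` {0..N})"
    by (intro compact_continuous_image continuous_on_subset[OF continuous_on_c0_apply]) auto
  then have 1: "bounded (c0_apply x ` {0..N})"
    by (rule compact_imp_bounded)
  have 2: "bounded (c0_apply x ` {N..})"
    by (rule boundedI[of _ 1]) (use N less_imp_le in auto)
  show ?thesis
    by (rule bounded_subset[OF iffD2[OF bounded_Un, OF conjI[OF 1 2]]]) force
qed

instantiation c0 :: real_vector
begin

lift_definition zero_c0 :: c0 is "\<lambda>_. 0"
  by auto

lift_definition plus_c0 :: "c0 \<Rightarrow> c0 \<Rightarrow> c0" is "\<lambda>x y t. x t + y t"
  by (auto intro!: continuous_intros tendsto_eq_intros)

lift_definition minus_c0 :: "c0 \<Rightarrow> c0 \<Rightarrow> c0" is "\<lambda>x y t. x t - y t"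
  by (auto intro!: continuous_intros tendsto_eq_intros)

lift_definition uminus_c0 :: "c0 \<Rightarrow> c0" is "\<lambda>x t. - x t"
  by (auto intro!: continuous_intros tendsto_eq_intros)

lift_definition scaleR_c0 :: "real \<Rightarrow> c0 \<Rightarrow> c0" is "\<lambda>r x t. r *\<^sub>R x t"
  by (auto intro!: continuous_intros tendsto_eq_intros)

instance
  by standard (transfer; auto simp: algebra_simps)+

end

lemmas c0_apply_simps [simp] =
  zero_c0.rep_eq plus_c0.rep_eq minus_c0.rep_eq uminus_c0.rep_eq scaleR_c0.rep_eq

instantiation c0 :: real_normed_vector
begin

definition norm_c0 :: "c0 \<Rightarrow> real"
  where "norm_c0 x = (SUP t\<in>{0..}. cmod (c0_apply x t))"

definition dist_c0 :: "c0 \<Rightarrow> c0 \<Rightarrow> real"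
  where "dist_c0 x y = norm (x - y)"

definition sgn_c0 :: "c0 \<Rightarrow> c0"
  where "sgn_c0 x = x /\<^sub>R norm x"

definition uniformity_c0 :: "(c0 \<times> c0) filter"
  where "uniformity_c0 = (INF e\<in>{0 <..}. principal {(x, y). dist x y < e})"

definition open_c0 :: "c0 set \<Rightarrow> bool"
  where "open_c0 U \<longleftrightarrow> (\<forall>x\<in>U. \<forall>\<^sub>F (x', y) in uniformity. x' = x \<longrightarrow> y \<in> U)"

lemma cmod_c0_apply_le_norm: "cmod (c0_apply x t) \<le> norm x"
proof -
  have bdd: "bdd_above ((\<lambda>t. cmod (c0_apply x t)) ` {0..})"
    using bounded_c0_apply[of x] by (auto simp: bounded_iff bdd_above_def)
  have *: "cmod (c0_apply x t) \<le> norm x" if "t \<ge> 0" for t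
    unfolding norm_c0_def by (rule cSUP_upper[OF _ bdd]) (use that in auto)
  have "0 \<le> norm x"
    using *[of 0] norm_ge_zero[of "c0_apply x 0"] by linarith
  then show ?thesis
    using * by (cases "t \<ge> 0") (auto simp: c0_apply_neg)
qed

lemma norm_c0_le: "(\<And>t. t \<ge> 0 \<Longrightarrow> cmod (c0_apply x t) \<le> B) \<Longrightarrow> norm x \<le> B"
  unfolding norm_c0_def by (rule cSUP_least) auto

instance
proof
  fix x y :: c0 and r :: real and U :: "c0 set"
  show "dist x y = norm (x - y)"
    by (rule dist_c0_def)
  show "sgn x = x /\<^sub>R norm x"
    by (rule sgn_c0_def)
  show "uniformity = (INF e\<in>{0 <..}. principal {(x :: c0, y). dist x y < e})"
    by (rule uniformity_c0_def)
  show "open U \<longleftrightarrow> (\<forall>x\<in>U. \<forall>\<^sub>F (x', y) in uniformity. x' = x \<longrightarrow> y \<in> U)"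
    by (rule open_c0_def)
  show "norm x = 0 \<longleftrightarrow> x = 0"
  proof
    assume "norm x = 0"
    then show "x = 0"
      using cmod_c0_apply_le_norm[of x] by (intro c0_eqI) auto
  next
    assume "x = 0"
    then show "norm x = 0"
      by (simp add: norm_c0_def)
  qed
  show "norm (x + y) \<le> norm x + norm y"
    by (rule norm_c0_le)
      (auto intro: norm_triangle_le add_mono cmod_c0_apply_le_norm)
  have le: "norm (r *\<^sub>R x) \<le> \<bar>r\<bar> * norm x" for r and x :: c0
    by (rule norm_c0_le) (auto intro: mult_left_mono cmod_c0_apply_le_norm)
  show "norm (r *\<^sub>R x) = \<bar>r\<bar> * norm x"
  proof (cases "r = 0")
    case True
    then show ?thesis
      by (simp add: norm_c0_def)
  next
    case False
    have "norm x \<le> \<bar>inverse r\<bar> * norm (r *\<^sub>R x)"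
      using le[of "inverse r" "r *\<^sub>R x"] False by simp
    then have "\<bar>r\<bar> * norm x \<le> norm (r *\<^sub>R x)"
      using False by (simp add: field_simps abs_inverse)
    with le[of r x] show ?thesis
      by simp
  qed
qed

end

instantiation c0 :: complex_banach
begin

lift_definition scaleC_c0 :: "complex \<Rightarrow> c0 \<Rightarrow> c0" is "\<lambda>c x t. c * x t"
  by (auto intro!: continuous_intros tendsto_eq_intros)

instance
proof
  fix x y :: c0 and c d :: complex and r :: real
  show "c *\<^sub>C (x + y) = c *\<^sub>C x + c *\<^sub>C y"
    by transfer (auto simp: algebra_simps)
  show "(c + d) *\<^sub>C x = c *\<^sub>C x + d *\<^sub>C x"
    by transfer (auto simp: algebra_simps)
  show "c *\<^sub>C (d *\<^sub>C x) = (c * d) *\<^sub>C x"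
    by transfer (auto simp: algebra_simps)
  show "complex_of_real r *\<^sub>C x = r *\<^sub>R x"
    by transfer (auto simp: scaleR_conv_of_real)
  have le: "norm (c *\<^sub>C x) \<le> cmod c * norm x" for c and x :: c0
    by (rule norm_c0_le)
      (auto simp: scaleC_c0.rep_eq norm_mult intro: mult_left_mono cmod_c0_apply_le_norm)
  show "norm (c *\<^sub>C x) = cmod c * norm x"
  proof (cases "c = 0")
    case True
    then show ?thesis
      using le[of c x] by simp
  next
    case False
    have "inverse c *\<^sub>C (c *\<^sub>C x) = x"
      using False by transfer auto
    then have "norm x \<le> cmod (inverse c) * norm (c *\<^sub>C x)"
      using le[of "inverse c" "c *\<^sub>C x"] by simp
    then have "cmod c * norm x \<le> norm (c *\<^sub>C x)"
      using False by (simp add: norm_divide field_simps)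
    with le[of c x] show ?thesis
      by simp
  qed
next
  fix X :: "nat \<Rightarrow> c0"
  assume "Cauchy X"
  have ucau: "\<exists>M. \<forall>m\<ge>M. \<forall>n\<ge>M. \<forall>t. dist (c0_apply (X m) t) (c0_apply (X n) t) < e"
    if "e > 0" for e
  proof -
    obtain M where M: "\<And>m n. m \<ge> M \<Longrightarrow> n \<ge> M \<Longrightarrow> dist (X m) (X n) < e"
      using \<open>Cauchy X\<close> \<open>e > 0\<close> unfolding Cauchy_def by blast
    have "dist (c0_apply (X m) t) (c0_apply (X n) t) < e" if "m \<ge> M" "n \<ge> M" for m n t
      using cmod_c0_apply_le_norm[of "X m - X n" t] M[OF that] by (simp add: dist_norm)
    then show ?thesis
      by blast
  qed
  have "uniformly_Cauchy_on UNIV (\<lambda>n. c0_apply (X n))"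
    unfolding uniformly_Cauchy_on_def using ucau by blast
  then obtain f where f: "uniform_limit UNIV (\<lambda>n. c0_apply (X n)) f sequentially"
    using uniformly_convergent_eq_Cauchy[of UNIV "\<lambda>n. c0_apply (X n)"]
    using Cauchy_uniformly_convergent uniformly_convergent_on_def by blast
  have cont: "continuous_on {0..} f"
    by (rule uniform_limit_theorem[OF _ uniform_limit_on_subset[OF f]])
      (auto intro: always_eventually continuous_on_c0_apply)
  have lim: "(f \<longlongrightarrow> 0) at_top"
    by (rule swap_uniform_limit'[where ?g="\<lambda>_. 0" and ?F=sequentially and f = "\<lambda>n. c0_apply (X n)" and S = UNIV])
      (auto intro: f always_eventually tendsto_c0_apply)
  have "f t = 0" if "t < 0" for t
    using tendsto_uniform_limitI[OF f, of t] that
    by (simp add: c0_apply_neg LIMSEQ_const_iff)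
  with cont lim have app: "c0_apply (Abs_c0 f) = f"
    by (intro Abs_c0_inverse) auto
  have "X \<longlonglongrightarrow> Abs_c0 f"
  proof (rule LIMSEQ_I)
    fix e :: real
    assume "e > 0"
    then have "eventually (\<lambda>n. \<forall>t\<in>UNIV. dist (c0_apply (X n) t) (f t) < e / 2) sequentially"
      using f unfolding uniform_limit_iff by (meson half_gt_zero)
    then obtain N where N: "\<And>n t. n \<ge> N \<Longrightarrow> dist (c0_apply (X n) t) (f t) < e / 2"
      by (auto simp: eventually_sequentially)
    have "norm (X n - Abs_c0 f) \<le> e / 2" if "n \<ge> N" for n
      by (rule norm_c0_le) (use N[OF that] less_imp_le in \<open>auto simp: app dist_norm\<close>)
    with \<open>e > 0\<close> show "\<exists>N. \<forall>n\<ge>N. norm (X n - Abs_c0 f) < e"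
      by (intro exI[of _ N]) fastforce
  qed
  then show "convergent X"
    by (rule convergentI)
qed

end

text \<open>
  For negative \<open>a\<close> the argument of \<open>Abs_c0\<close> need not lie in the carrier of the typedef,
  and the value is then unspecified.
\<close>

definition weighted_left_translation :: "complex \<Rightarrow> real \<Rightarrow> c0 \<Rightarrow> c0"
  where "weighted_left_translation w a x =
    Abs_c0 (\<lambda>t. if t \<ge> 0 then w * c0_apply x (t + a) else 0)"

lemma weighted_left_translation_apply:
  assumes "a \<ge> 0" and "t \<ge> 0"
  shows "c0_apply (weighted_left_translation w a x) t = w * c0_apply x (t + a)"
proof -
  let ?f = "\<lambda>t. if t \<ge> 0 then w * c0_apply x (t + a) else 0"
  have "continuous_on {0..} (\<lambda>t. w * c0_apply x (t + a))"
    by (intro continuous_intros continuous_on_compose2[OF continuous_on_c0_apply])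
      (use assms in auto)
  then have 1: "continuous_on {0..} ?f"
    by (rule continuous_on_eq) auto
  have "filterlim (\<lambda>t. t + a) at_top at_top"
    by (rule filterlim_tendsto_add_at_top[OF tendsto_const filterlim_ident,
          of a, simplified add.commute])
  then have "((\<lambda>t. w * c0_apply x (t + a)) \<longlongrightarrow> 0) at_top"
    by (intro tendsto_mult_right_zero filterlim_compose[OF tendsto_c0_apply])
  then have 2: "(?f \<longlongrightarrow> 0) at_top"
    by (rule Lim_transform_eventually)
      (auto intro: eventually_mono[OF eventually_ge_at_top[of 0]])
  from 1 2 have "c0_apply (Abs_c0 ?f) = ?f"
    by (intro Abs_c0_inverse) auto
  then show ?thesis
    using assms by (simp add: weighted_left_translation_def)
qed

end

theory Submission
  imports Defs
begin

text \<open>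
  Put \<open>T = weighted_left_translation w a\<close>. Its norm is at most \<open>cmod w\<close>, so when
  \<open>cmod l > cmod w\<close> the equation \<open>T x - l x = y\<close> is a fixed-point problem for a contraction;
  Banach's theorem gives bijectivity and the norm estimate gives a bounded inverse
  (\<open>resolvent_setI_norm_bound\<close>).

  On the half-line, \<open>T x = l x\<close> says \<open>x (t + a) = q x t\<close> with \<open>q = l / w\<close>. For \<open>cmod q < 1\<close>
  the exponential \<open>q powr (t / a)\<close> solves this and decays (for \<open>q = 0\<close> a function supported in
  \<open>[0, a]\<close> does), so every such \<open>l\<close> is an eigenvalue (\<open>point_spectrum_of_small\<close>).

  On the circle \<open>cmod l = cmod w\<close> the operator \<open>U = T / l\<close> satisfies
  \<open>cmod (U\<^sup>n x t) = cmod (x (t + n a))\<close>, so its powers tend strongly to zero. This alone yields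
  both injectivity and dense range of \<open>T - l\<close>: a solution of \<open>U x = x\<close> equals its iterates, which
  vanish in the limit, and \<open>y - U\<^sup>n y\<close> is in the range of \<open>I - U\<close> and tends to \<open>y\<close>
  (\<open>inj_shifted_op_of_stable\<close>, \<open>dense_range_shifted_op_of_stable\<close>). Surjectivity fails by
  resonance: for the right-hand side \<open>q powr (t / a) / (1 + t)\<close>, the values of a solution along
  \<open>t = n a\<close>, after removal of the rotation \<open>q ^ n\<close>, are partial sums of a divergent
  harmonic-type series, although they must tend to zero (\<open>not_surj_on_circle\<close>).
\<close>

section \<open>Spectral criteria in complex Banach spaces\<close>

lemma bounded_linear_scaleC:
  "bounded_linear (\<lambda>x :: 'a :: complex_normed_vector. c *\<^sub>C x)"
proof (rule bounded_linear_intro)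
  fix x y :: 'a and r :: real
  show "c *\<^sub>C (x + y) = c *\<^sub>C x + c *\<^sub>C y"
    by (rule scaleC_add_right)
  show "c *\<^sub>C (r *\<^sub>R x) = r *\<^sub>R (c *\<^sub>C x)"
    by (simp flip: scaleC_of_real add: scaleC_scaleC mult.commute)
  show "norm (c *\<^sub>C x) \<le> norm x * cmod c"
    by (simp add: norm_scaleC)
qed

lemma scaleC_diff_right: "c *\<^sub>C (x - y) = c *\<^sub>C x - c *\<^sub>C y"
  for x y :: "'a :: complex_normed_vector"
  by (rule linear_diff[OF bounded_linear.linear[OF bounded_linear_scaleC]])

lemma scaleC_one: "1 *\<^sub>C x = x" for x :: "'a :: complex_normed_vector"
  using scaleC_of_real[of 1 x] by simp

lemma scaleC_inverse_eq_iff: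
  fixes x y :: "'a :: complex_normed_vector"
  assumes "c \<noteq> 0"
  shows "inverse c *\<^sub>C x = y \<longleftrightarrow> x = c *\<^sub>C y"
  using assms by (metis scaleC_scaleC scaleC_one left_inverse right_inverse)

lemma linear_shifted_op:
  assumes "bounded_clinear T"
  shows "linear (shifted_op T l)"
  using assms unfolding shifted_op_def bounded_clinear_def
  by (intro linear_compose_sub bounded_linear.linear bounded_linear_scaleC) auto

lemma shifted_op_scaleC:
  assumes "bounded_clinear T"
  shows "shifted_op T l (c *\<^sub>C x) = c *\<^sub>C shifted_op T l x"
  using assms by (simp add: shifted_op_def bounded_clinear_def scaleC_diff_right scaleC_scaleC
      mult.commute)

lemma bij_shifted_op_of_resolvent_set: "l \<in> resolvent_set T \<Longrightarrow> bij (shifted_op T l)"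
  unfolding resolvent_set_def by (auto intro: o_bij)

text \<open>
  Read at \<open>x = S y\<close> for the algebraic inverse \<open>S\<close> of \<open>T - l\<close>, the lower estimate becomes
  \<open>norm (S y) \<le> norm y / d\<close>.
\<close>

lemma resolvent_setI_bounded_below:
  assumes T: "bounded_clinear T" and bij: "bij (shifted_op T l)"
    and d: "d > 0" and below: "\<And>x. d * norm x \<le> norm (shifted_op T l x)"
  shows "l \<in> resolvent_set T"
proof -
  let ?A = "shifted_op T l" and ?S = "inv (shifted_op T l)"
  have AS: "?A (?S y) = y" for y
    using bij by (simp add: bij_is_surj surj_f_inv_f)
  have SA: "?S (?A x) = x" for x
    using bij by (simp add: bij_is_inj)
  have lin: "linear ?A"
    by (rule linear_shifted_op[OF T])
  have "bounded_linear ?S"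
  proof (rule bounded_linear_intro)
    fix x y and r :: real
    show "?S (x + y) = ?S x + ?S y"
      by (metis AS SA linear_add[OF lin])
    show "?S (r *\<^sub>R x) = r *\<^sub>R ?S x"
      by (metis AS SA linear_scale[OF lin])
    show "norm (?S x) \<le> norm x * (1 / d)"
      using below[of "?S x"] d by (simp add: AS field_simps)
  qed
  moreover have "?S (c *\<^sub>C x) = c *\<^sub>C ?S x" for c x
    by (metis AS SA shifted_op_scaleC[OF T])
  ultimately have "bounded_clinear ?S"
    by (simp add: bounded_clinear_def)
  then show ?thesis
    unfolding resolvent_set_def using AS SA by (auto simp: fun_eq_iff intro!: exI[of _ ?S])
qed

text \<open>
  For \<open>l\<close> outside the disc of radius \<open>c\<close>, solving \<open>T x - l x = y\<close> means finding a fixed point of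
  \<open>x \<mapsto> (T x - y) / l\<close>, which contracts by the factor \<open>c / cmod l\<close>; this replaces summing the
  Neumann series.
\<close>

lemma resolvent_setI_norm_bound:
  fixes T :: "'a :: complex_banach \<Rightarrow> 'a"
  assumes T: "bounded_clinear T" and bound: "\<And>x. norm (T x) \<le> c * norm x"
    and c: "0 \<le> c" "c < cmod l"
  shows "l \<in> resolvent_set T"
proof (rule resolvent_setI_bounded_below[OF T])
  have l: "l \<noteq> 0"
    using c by auto
  have "\<exists>!x. inverse l *\<^sub>C (T x - y) = x" for y
  proof (rule banach_fix_type[of "c / cmod l"])
    show "\<forall>x x'. dist (inverse l *\<^sub>C (T x - y)) (inverse l *\<^sub>C (T x' - y)) \<le> c / cmod l * dist x x'"
    proof (intro allI)
      fix x x'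
      have "dist (inverse l *\<^sub>C (T x - y)) (inverse l *\<^sub>C (T x' - y))
          = cmod (inverse l) * norm (T (x - x'))"
        using T by (simp add: dist_norm bounded_clinear_def linear_diff bounded_linear.linear
            norm_scaleC flip: scaleC_diff_right)
      also have "\<dots> \<le> cmod (inverse l) * (c * norm (x - x'))"
        by (intro mult_left_mono bound) auto
      finally show "dist (inverse l *\<^sub>C (T x - y)) (inverse l *\<^sub>C (T x' - y))
          \<le> c / cmod l * dist x x'"
        using l by (simp only: dist_norm norm_inverse divide_inverse) (simp add: mult_ac)
    qed
  qed (use c l in \<open>auto simp: divide_simps\<close>)
  then have "\<exists>!x. shifted_op T l x = y" for y
    using l by (simp add: scaleC_inverse_eq_iff shifted_op_def algebra_simps)
  then have ex1: "\<exists>!x. shifted_op T l x = y" for y .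
  show "bij (shifted_op T l)"
    unfolding bij_def inj_on_def surj_def using ex1 by metis
  show "cmod l - c > 0"
    using c by simp
  show "(cmod l - c) * norm x \<le> norm (shifted_op T l x)" for x
    using norm_triangle_ineq2[of "l *\<^sub>C x" "T x"] bound[of x]
    by (simp add: shifted_op_def norm_scaleC norm_minus_commute left_diff_distrib)
qed

text \<open>
  A solution of \<open>T x = l x\<close> is fixed by every power of \<open>T / l\<close>, hence is its own limit under them.
\<close>

lemma inj_shifted_op_of_stable:
  fixes T :: "'a :: complex_banach \<Rightarrow> 'a"
  assumes T: "bounded_clinear T" and l: "l \<noteq> 0"
    and stable: "\<And>x. (\<lambda>n. ((\<lambda>x. inverse l *\<^sub>C T x) ^^ n) x) \<longlonglongrightarrow> 0"
  shows "inj (shifted_op T l)"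
proof -
  have "x = 0" if "shifted_op T l x = 0" for x
  proof -
    have "inverse l *\<^sub>C T x = x"
      using that l by (simp add: shifted_op_def scaleC_inverse_eq_iff)
    then have "((\<lambda>x. inverse l *\<^sub>C T x) ^^ n) x = x" for n
      by (induction n) auto
    with stable[of x] show ?thesis
      by (simp add: LIMSEQ_const_iff)
  qed
  then show ?thesis
    using linear_injective_0[OF linear_shifted_op[OF T]] by blast
qed

text \<open>
  With \<open>U = T / l\<close>, the vector \<open>y - U\<^sup>n y\<close> telescopes into terms \<open>z - U z\<close>, each of which lies in
  the range of \<open>T - l\<close>; as \<open>U\<^sup>n y\<close> vanishes in the limit, these vectors approximate \<open>y\<close>.
\<close>

lemma dense_range_shifted_op_of_stable:
  fixes T :: "'a :: complex_banach \<Rightarrow> 'a"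
  assumes T: "bounded_clinear T" and l: "l \<noteq> 0"
    and stable: "\<And>x. (\<lambda>n. ((\<lambda>x. inverse l *\<^sub>C T x) ^^ n) x) \<longlonglongrightarrow> 0"
  shows "closure (range (shifted_op T l)) = UNIV"
proof -
  let ?U = "\<lambda>x. inverse l *\<^sub>C T x" and ?R = "range (shifted_op T l)"
  have R: "subspace ?R"
    by (rule linear_subspace_image[OF linear_shifted_op[OF T] subspace_UNIV])
  have step: "z - ?U z \<in> ?R" for z
  proof -
    have "shifted_op T l (- (inverse l *\<^sub>C z)) = - (inverse l *\<^sub>C shifted_op T l z)"
      by (simp add: linear_neg[OF linear_shifted_op[OF T]] shifted_op_scaleC[OF T])
    also have "\<dots> = z - ?U z"
      using l by (simp add: shifted_op_def scaleC_diff_right scaleC_scaleC scaleC_one)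
    finally show ?thesis
      by (metis rangeI)
  qed
  have iter: "y - (?U ^^ n) y \<in> ?R" for y n
  proof (induction n)
    case 0
    then show ?case
      using subspace_0[OF R] by simp
  next
    case (Suc n)
    then show ?case
      using subspace_add[OF R Suc.IH step[of "(?U ^^ n) y"]] by simp
  qed
  have "y \<in> closure ?R" for y
  proof -
    have "(\<lambda>n. y - (?U ^^ n) y) \<longlonglongrightarrow> y - 0"
      by (intro tendsto_diff tendsto_const stable)
    then show ?thesis
      unfolding closure_sequential using iter
      by (intro exI[of _ "\<lambda>n. y - (?U ^^ n) y"]) simp
  qed
  then show ?thesis
    by auto
qed

section \<open>The weighted left translation\<close>

lemma c0_obtain:
  assumes "continuous_on {0..} f" and "(f \<longlongrightarrow> 0) at_top"
  obtains x where "\<And>t. t \<ge> 0 \<Longrightarrow> c0_apply x t = f t"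
proof
  let ?f = "\<lambda>t. if t \<ge> 0 then f t else 0"
  have "continuous_on {0..} ?f"
    by (rule continuous_on_eq[OF assms(1)]) auto
  moreover have "(?f \<longlongrightarrow> 0) at_top"
    by (rule Lim_transform_eventually[OF assms(2)])
      (auto intro: eventually_mono[OF eventually_ge_at_top[of 0]])
  ultimately have "c0_apply (Abs_c0 ?f) = ?f"
    by (intro Abs_c0_inverse) auto
  then show "c0_apply (Abs_c0 ?f) t = f t" if "t \<ge> 0" for t
    using that by simp
qed

lemma norm_weighted_left_translation_le:
  assumes "a \<ge> 0"
  shows "norm (weighted_left_translation w a x) \<le> cmod w * norm x"
  by (rule norm_c0_le) (use assms in \<open>auto simp: weighted_left_translation_apply norm_mult
        intro!: mult_left_mono cmod_c0_apply_le_norm\<close>)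

lemma bounded_clinear_weighted_left_translation:
  assumes "a \<ge> 0"
  shows "bounded_clinear (weighted_left_translation w a)"
proof -
  have "bounded_linear (weighted_left_translation w a)"
  proof (rule bounded_linear_intro)
    show "norm (weighted_left_translation w a x) \<le> norm x * cmod w" for x
      using norm_weighted_left_translation_le[OF assms, of w x] by (simp add: mult.commute)
  qed (rule c0_eqI, use assms in \<open>simp add: weighted_left_translation_apply algebra_simps\<close>)+
  moreover have "weighted_left_translation w a (c *\<^sub>C x) = c *\<^sub>C weighted_left_translation w a x"
    for c x
    by (rule c0_eqI) (use assms in \<open>simp add: weighted_left_translation_apply scaleC_c0.rep_eq\<close>)
  ultimately show ?thesis
    by (simp add: bounded_clinear_def)
qed

lemma shifted_weighted_left_translation_apply:
  assumes "a \<ge> 0" "t \<ge> 0"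
  shows "c0_apply (shifted_op (weighted_left_translation w a) l x) t
    = w * c0_apply x (t + a) - l * c0_apply x t"
  using assms by (simp add: shifted_op_def weighted_left_translation_apply scaleC_c0.rep_eq)

lemma weighted_left_translation_funpow_apply:
  assumes "a \<ge> 0" "t \<ge> 0"
  shows "c0_apply (((\<lambda>x. c *\<^sub>C weighted_left_translation w a x) ^^ n) x) t
    = (c * w) ^ n * c0_apply x (t + real n * a)"
  using assms(2)
proof (induction n arbitrary: t)
  case (Suc n)
  then show ?case
    using assms(1) Suc.IH[of "t + a"]
    by (simp add: scaleC_c0.rep_eq weighted_left_translation_apply algebra_simps)
qed auto

text \<open>
  Iterating moves ever later values of \<open>x\<close> to the origin without enlarging them, and the supremum
  of \<open>cmod (x s)\<close> over \<open>s \<ge> n * a\<close> vanishes in the limit.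
\<close>

lemma weighted_left_translation_stable:
  assumes "a > 0" "cmod (c * w) \<le> 1"
  shows "(\<lambda>n. ((\<lambda>x. c *\<^sub>C weighted_left_translation w a x) ^^ n) x) \<longlonglongrightarrow> 0"
proof (rule LIMSEQ_I)
  let ?U = "\<lambda>x. c *\<^sub>C weighted_left_translation w a x"
  fix e :: real
  assume e: "e > 0"
  then have "eventually (\<lambda>t. cmod (c0_apply x t) < e / 2) at_top"
    using tendstoD[OF tendsto_c0_apply, of "e / 2" x] by (simp add: dist_norm)
  then obtain N where N: "\<And>t. t \<ge> N \<Longrightarrow> cmod (c0_apply x t) < e / 2"
    by (auto simp: eventually_at_top_linorder)
  obtain m where m: "real m * a > N"
    using ex_less_of_nat_mult[OF assms(1), of N] by auto
  have "norm ((?U ^^ n) x) \<le> e / 2" if "n \<ge> m" for n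
  proof (rule norm_c0_le)
    fix t :: real
    assume t: "t \<ge> 0"
    have "real m * a \<le> real n * a"
      using that assms by (intro mult_right_mono) auto
    then have "cmod (c0_apply x (t + real n * a)) \<le> e / 2"
      using m t by (intro less_imp_le N) linarith
    moreover have "cmod (c * w) ^ n \<le> 1"
      by (intro power_le_one assms norm_ge_zero)
    ultimately have "cmod (c * w) ^ n * cmod (c0_apply x (t + real n * a)) \<le> 1 * (e / 2)"
      by (intro mult_mono) auto
    then show "cmod (c0_apply ((?U ^^ n) x) t) \<le> e / 2"
      using t assms(1)
      by (simp add: weighted_left_translation_funpow_apply norm_mult norm_power)
  qed
  with e show "\<exists>m. \<forall>n\<ge>m. norm ((?U ^^ n) x - 0) < e"
    by (intro exI[of _ m]) fastforce
qed

section \<open>Eigenvectors inside the disc\<close>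

lemma continuous_on_powr_scaled:
  assumes "q \<noteq> 0"
  shows "continuous_on S (\<lambda>t. q powr complex_of_real (t / a))"
  using assms unfolding powr_def divide_inverse by (auto intro!: continuous_intros)

lemma powr_scaled_shift:
  assumes "a \<noteq> 0"
  shows "q powr complex_of_real ((t + a) / a) = q * q powr complex_of_real (t / a)"
  using assms by (simp add: add_divide_distrib powr_add mult.commute)

lemma cmod_powr_scaled: "cmod (q powr complex_of_real (t / a)) = cmod q powr (t / a)"
  by (subst norm_powr_real_powr') auto

lemma point_spectrum_of_small:
  assumes a: "a > 0" and l: "cmod l < cmod w"
  shows "l \<in> point_spectrum (weighted_left_translation w a)"
proof -
  have w: "w \<noteq> 0"
    using l by auto
  define q where "q = l / w"
  have q: "cmod q < 1"
    using l w by (simp add: q_def norm_divide)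
  obtain x where x0: "c0_apply x 0 \<noteq> 0"
    and x: "\<And>t. t \<ge> 0 \<Longrightarrow> c0_apply x (t + a) = q * c0_apply x t"
  proof (cases "q = 0")
    \<comment> \<open>Here \<open>l = 0\<close>, and the translation annihilates every function supported in \<open>[0, a]\<close>.\<close>
    case True
    let ?f = "\<lambda>t. complex_of_real (max 0 (1 - t / a))"
    have "eventually (\<lambda>t. ?f t = 0) at_top"
      using eventually_ge_at_top[of a] by eventually_elim (use a in \<open>simp add: field_simps\<close>)
    then have "(?f \<longlongrightarrow> 0) at_top"
      by (rule tendsto_eventually)
    moreover have "continuous_on {0..} ?f"
      using a by (intro continuous_intros) auto
    ultimately obtain x where "\<And>t. t \<ge> 0 \<Longrightarrow> c0_apply x t = ?f t"
      using c0_obtain by blast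
    then show ?thesis
      using a True by (intro that[of x]) (auto simp: add_divide_distrib max_def)
  next
    case False
    let ?f = "\<lambda>t. q powr complex_of_real (t / a)"
    have "((\<lambda>t. exp (ln (cmod q) / a * t)) \<longlongrightarrow> 0) at_top"
    proof -
      have "ln (cmod q) / a < 0"
        using False q a by (simp add: divide_neg_pos)
      then show ?thesis
        by (intro filterlim_compose[OF exp_at_bot]
            filterlim_tendsto_neg_mult_at_bot[OF tendsto_const _ filterlim_ident])
    qed
    then have "((\<lambda>t. cmod (?f t)) \<longlongrightarrow> 0) at_top"
      using False unfolding cmod_powr_scaled powr_def by (simp add: mult.commute)
    then have "(?f \<longlongrightarrow> 0) at_top"
      by (rule tendsto_norm_zero_cancel)
    then obtain x where "\<And>t. t \<ge> 0 \<Longrightarrow> c0_apply x t = ?f t"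
      using c0_obtain[OF continuous_on_powr_scaled[OF False]] by blast
    then show ?thesis
      using a False by (intro that[of x]) (simp_all add: powr_scaled_shift del: of_real_divide)
  qed
  have "shifted_op (weighted_left_translation w a) l x = 0"
    by (rule c0_eqI) (use a w x in
        \<open>simp add: shifted_weighted_left_translation_apply q_def\<close>)
  moreover have "shifted_op (weighted_left_translation w a) l 0 = 0"
    using a by (intro linear_0 linear_shifted_op bounded_clinear_weighted_left_translation) auto
  moreover have "x \<noteq> 0"
    using x0 by auto
  ultimately show ?thesis
    unfolding point_spectrum_def mem_Collect_eq by (metis injD)
qed

section \<open>Failure of surjectivity on the circle\<close>

lemma not_summable_inverse_arithmetic:
  fixes a :: real
  assumes "a \<ge> 0"
  shows "\<not> summable (\<lambda>n. 1 / (1 + real n * a))"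
proof
  assume "summable (\<lambda>n. 1 / (1 + real n * a))"
  then have "summable (\<lambda>n. (1 + a) * (1 / (1 + real n * a)))"
    by (rule summable_mult)
  then have "summable (\<lambda>n. 1 / real (Suc n))"
  proof (rule summable_comparison_test')
    fix n :: nat
    have "0 < 1 + real n * a"
      using assms by (simp add: add_pos_nonneg)
    then show "norm (1 / real (Suc n)) \<le> (1 + a) * (1 / (1 + real n * a))"
      using assms by (simp add: field_simps)
  qed
  then have "summable (\<lambda>n. inverse (real (Suc n)))"
    by (simp add: inverse_eq_divide)
  then show False
    using not_summable_harmonic[where 'a = real] by (subst (asm) summable_Suc_iff) simp
qed

text \<open>
  Along \<open>t = n * a\<close> a solution of \<open>T x - l x = y\<close> obeys a first-order recurrence whose homogeneous
  solutions are multiples of \<open>q ^ n\<close>. Choosing \<open>y\<close> in phase with \<open>q ^ n\<close> makes all increments of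
  \<open>x (n * a) / q ^ n\<close> point in the same direction, and the slow decay \<open>1 / (1 + t)\<close> makes them add
  up to infinity.
\<close>

lemma not_surj_on_circle:
  assumes a: "a > 0" and w: "w \<noteq> 0" and l: "cmod l = cmod w"
  shows "\<not> surj (shifted_op (weighted_left_translation w a) l)"
proof
  assume surj: "surj (shifted_op (weighted_left_translation w a) l)"
  define q where "q = l / w"
  have q: "cmod q = 1" "q \<noteq> 0"
    using l w by (auto simp: q_def norm_divide)
  have lq: "l = w * q"
    using w by (simp add: q_def)
  let ?g = "\<lambda>t. q powr complex_of_real (t / a) * complex_of_real (inverse (1 + t))"
  have "((\<lambda>t. inverse (1 + t) :: real) \<longlongrightarrow> 0) at_top"
    by (rule tendsto_inverse_0_at_top[OF
          filterlim_tendsto_add_at_top[OF tendsto_const filterlim_ident]])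
  then have "((\<lambda>t. \<bar>inverse (1 + t)\<bar> :: real) \<longlongrightarrow> 0) at_top"
    by (rule tendsto_rabs_zero)
  then have "((\<lambda>t. cmod (?g t)) \<longlongrightarrow> 0) at_top"
    unfolding norm_mult cmod_powr_scaled norm_of_real q powr_one_eq_one by simp
  then have "(?g \<longlongrightarrow> 0) at_top"
    by (rule tendsto_norm_zero_cancel)
  moreover have "continuous_on {0..} ?g"
    using q by (intro continuous_on_mult continuous_on_powr_scaled continuous_on_of_real
        continuous_on_inverse continuous_on_add continuous_on_const continuous_on_id) auto
  ultimately obtain y where y: "\<And>t. t \<ge> 0 \<Longrightarrow> c0_apply y t = ?g t"
    using c0_obtain by blast
  from surj obtain x where x: "shifted_op (weighted_left_translation w a) l x = y"
    by (metis surjD)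
  have rec: "w * c0_apply x (real n * a + a) - l * c0_apply x (real n * a)
      = q ^ n * complex_of_real (1 / (1 + real n * a))" for n
    using shifted_weighted_left_translation_apply[of a "real n * a" w l x] x y[of "real n * a"] a q
    by (simp add: powr_nat inverse_eq_divide)
  \<comment> \<open>Dividing by \<open>q ^ n\<close> turns the recurrence into \<open>l * (z (Suc n) - z n) = 1 / (1 + n a)\<close>, while
    \<open>cmod q = 1\<close> keeps the decay of \<open>x\<close>.\<close>
  define z where "z n = c0_apply x (real n * a) / q ^ n" for n
  have "filterlim (\<lambda>n. real n * a) at_top sequentially"
    by (rule filterlim_at_top_mult_tendsto_pos[OF tendsto_const a filterlim_real_sequentially])
  then have "(\<lambda>n. c0_apply x (real n * a)) \<longlonglongrightarrow> 0"
    by (rule filterlim_compose[OF tendsto_c0_apply])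
  then have "(\<lambda>n. cmod (z n)) \<longlonglongrightarrow> 0"
    by (simp add: z_def norm_divide norm_power q tendsto_norm_zero)
  then have "z \<longlonglongrightarrow> 0"
    by (rule tendsto_norm_zero_cancel)
  then have "summable (\<lambda>n. z (Suc n) - z n)"
    by (rule telescope_summable)
  then have "summable (\<lambda>n. l * (z (Suc n) - z n))"
    by (rule summable_mult)
  moreover have "l * (z (Suc n) - z n) = complex_of_real (1 / (1 + real n * a))" for n
  proof -
    have "l * (z (Suc n) - z n)
        = (w * c0_apply x (real n * a + a) - l * c0_apply x (real n * a)) / q ^ n"
      using q by (simp add: z_def lq field_simps)
    then show ?thesis
      using q by (simp add: rec)
  qed
  ultimately have "summable (\<lambda>n. complex_of_real (1 / (1 + real n * a)))"
    by simp
  then have "summable (\<lambda>n. 1 / (1 + real n * a))"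
    by (simp only: summable_of_real_iff)
  then show False
    using not_summable_inverse_arithmetic[of a] a by simp
qed

section \<open>The spectrum and its parts\<close>

theorem proposition5p1:
  fixes w :: complex and a :: real
  assumes "cmod w > 1" and "a > 0"
  shows "bounded_clinear (weighted_left_translation w a)
    \<and> spectrum (weighted_left_translation w a) = {l. cmod l \<le> cmod w}
    \<and> point_spectrum (weighted_left_translation w a) = {l. cmod l < cmod w}
    \<and> continuous_spectrum (weighted_left_translation w a) = {l. cmod l = cmod w}"
proof -
  let ?T = "weighted_left_translation w a"
  have w: "w \<noteq> 0" and a: "a \<ge> 0"
    using assms by auto
  have T: "bounded_clinear ?T"
    by (rule bounded_clinear_weighted_left_translation[OF a])
  have small: "\<not> inj (shifted_op ?T l)" if "cmod l < cmod w" for l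
    using point_spectrum_of_small[OF assms(2) that] by (simp add: point_spectrum_def)
  have large: "l \<in> resolvent_set ?T" if "cmod l > cmod w" for l
    by (rule resolvent_setI_norm_bound[OF T norm_weighted_left_translation_le[OF a]])
      (use that in auto)
  have circle: "inj (shifted_op ?T l)" "closure (range (shifted_op ?T l)) = UNIV"
    "\<not> surj (shifted_op ?T l)" if l: "cmod l = cmod w" for l
  proof -
    have l0: "l \<noteq> 0"
      using l w by auto
    have stable: "(\<lambda>n. ((\<lambda>x. inverse l *\<^sub>C ?T x) ^^ n) x) \<longlonglongrightarrow> 0" for x
      by (rule weighted_left_translation_stable[OF assms(2)])
        (use l w in \<open>simp add: norm_mult norm_inverse\<close>)
    show "inj (shifted_op ?T l)"
      by (rule inj_shifted_op_of_stable[OF T l0 stable])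
    show "closure (range (shifted_op ?T l)) = UNIV"
      by (rule dense_range_shifted_op_of_stable[OF T l0 stable])
    show "\<not> surj (shifted_op ?T l)"
      by (rule not_surj_on_circle[OF assms(2) w l])
  qed
  have bij: "inj (shifted_op ?T l)" "surj (shifted_op ?T l)" if "l \<in> resolvent_set ?T" for l
    using bij_shifted_op_of_resolvent_set[OF that] by (auto simp: bij_def)
  have resolvent: "l \<in> resolvent_set ?T \<longleftrightarrow> cmod l > cmod w" for l
    using small[of l] circle(3)[of l] large[of l] bij[of l]
    by (cases "cmod l" "cmod w" rule: linorder_cases) auto
  have inj: "inj (shifted_op ?T l) \<longleftrightarrow> \<not> cmod l < cmod w" for l
    using small[of l] circle(1)[of l] large[of l] bij(1)[of l]
    by (cases "cmod l" "cmod w" rule: linorder_cases) auto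
  have surj: "surj (shifted_op ?T l)" if "cmod l > cmod w" for l
    by (rule bij(2)[OF large[OF that]])
  have "spectrum ?T = {l. cmod l \<le> cmod w}"
    by (auto simp: spectrum_def resolvent)
  moreover have "point_spectrum ?T = {l. cmod l < cmod w}"
    by (simp add: point_spectrum_def inj)
  moreover have "l \<in> continuous_spectrum ?T \<longleftrightarrow> cmod l = cmod w" for l
    using small[of l] circle[of l] surj[of l]
    by (cases "cmod l" "cmod w" rule: linorder_cases) (auto simp: continuous_spectrum_def)
  then have "continuous_spectrum ?T = {l. cmod l = cmod w}"
    by blast
  ultimately show ?thesis
    using T by blast
qed

end
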